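(* Let $0\le k\le d+1$ and let $B$ be a homology $(d+1)$-ball. Then $B$ is $k$-shelled if and only if $B$ is shellable and $k$-stacked.
   Context: Simplicial complexes are finite and contain the empty set as a face. For a finite set $\alpha$, $\overline{\alpha}$ is the complex of all subsets of $\alpha$, $\partial\alpha$ the complex of all proper subsets, and $\dim(\alpha)=\#(\alpha)-1$; $\ast$ denotes join. The standard ball $B^d_{d+1}$ is the face complex of a $d$-simplex. A weak pseudomanifold is a pure $d$-dimensional complex in which each $(d-1)$-face lies in at most two facets; it is a pseudomanifold if its dual graph (facets as vertices, adjacent when meeting in a codimension-one face) is connected. Shelling moves: for pure $d$-dimensional complexes $X,Y$, $X$ is obtained from $Y$ by the shelling move $\alpha\leadsto\beta$ if $\alpha$ and $\beta\ne\emptyset$ are disjoint faces of $X$ such that $Y\subseteq X$, $\alpha\sqcup\beta$ is the only facet of $X$ which is not a facet of $Y$, and the induced subcomplex of $Y$ on $\alpha\sqcup\beta$ is $\overline{\alpha}\ast\partial\beta$. Its index is $\dim(\beta)$. A $d$-dimensional complex is shellable if it is obtained from $B^d_{d+1}$ by a finite (possibly empty) sequence of shelling moves. For $0\le k\le d$, a $d$-dimensional pseudomanifold is $k$-shelled if it is obtained from $B^d_{d+1}$ by a finite (possibly empty) sequence of shelling moves each of index $<k$. A homology ball means an $\mathbb{F}$-homology ball for some field $\mathbb{F}$. An $\mathbb{F}$-homology $d$-sphere is a $d$-dimensional complex in which the link of every face $\sigma$ (including $\emptyset$) has the reduced $\mathbb{F}$-homology of a $(d-\dim(\sigma)-1)$-sphere.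 An $\mathbb{F}$-homology $d$-ball is a $d$-dimensional $\mathbb{F}$-acyclic complex in which the link of every non-empty face $\sigma$ has the reduced homology of a $(d-\dim(\sigma)-1)$-sphere or of a point, and whose faces with acyclic link form an $\mathbb{F}$-homology $(d-1)$-sphere, its boundary (equivalently, the pure subcomplex whose facets are the $(d-1)$-faces lying in exactly one facet). A homology $(d+1)$-ball is $k$-stacked if all its faces of codimension at least $k+1$ (dimension $\le d-k$) lie in its boundary. *)

theory Defs
  imports "HOL-Library.Function_Algebras"
begin

section \<open>Finite simplicial complexes\<close>

definition simplicial_complex :: "'a set set \<Rightarrow> bool" where
  "simplicial_complex K \<longleftrightarrow>
     finite K \<and> {} \<in> K \<and> (\<forall>\<sigma>\<in>K. finite \<sigma> \<and> (\<forall>\<tau>. \<tau> \<subseteq> \<sigma> \<longrightarrow> \<tau> \<in> K))"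

text \<open>Dimensions are integers, since the empty face has dimension \<open>-1\<close>.\<close>

definition face_dim :: "'a set \<Rightarrow> int" where
  "face_dim \<sigma> = int (card \<sigma>) - 1"

definition complex_dim :: "'a set set \<Rightarrow> int" where
  "complex_dim K = Max (face_dim ` K)"

definition facets :: "'a set set \<Rightarrow> 'a set set" where
  "facets K = {\<sigma>\<in>K. \<forall>\<tau>\<in>K. \<sigma> \<subseteq> \<tau> \<longrightarrow> \<sigma> = \<tau>}"

definition pure_complex :: "int \<Rightarrow> 'a set set \<Rightarrow> bool" where
  "pure_complex d K \<longleftrightarrow> simplicial_complex K \<and> (\<forall>\<sigma>\<in>facets K. face_dim \<sigma> = d)"

definition face_complex :: "'a set \<Rightarrow> 'a set set" where
  "face_complex \<alpha> = {\<tau>. \<tau> \<subseteq> \<alpha>}"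

definition boundary_complex :: "'a set \<Rightarrow> 'a set set" where
  "boundary_complex \<alpha> = {\<tau>. \<tau> \<subset> \<alpha>}"

text \<open>Only used for complexes on disjoint vertex sets.\<close>

definition join :: "'a set set \<Rightarrow> 'a set set \<Rightarrow> 'a set set" where
  "join K L = {\<sigma> \<union> \<tau> |\<sigma> \<tau>. \<sigma> \<in> K \<and> \<tau> \<in> L}"

definition link :: "'a set set \<Rightarrow> 'a set \<Rightarrow> 'a set set" where
  "link K \<sigma> = {\<tau>. \<sigma> \<inter> \<tau> = {} \<and> \<sigma> \<union> \<tau> \<in> K}"

definition induced_subcomplex :: "'a set set \<Rightarrow> 'a set \<Rightarrow> 'a set set" where
  "induced_subcomplex K A = {\<sigma>\<in>K. \<sigma> \<subseteq> A}"

definition weak_pseudomanifold :: "int \<Rightarrow> 'a set set \<Rightarrow> bool" where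
  "weak_pseudomanifold d K \<longleftrightarrow>
     pure_complex d K \<and> (\<forall>\<tau>\<in>K. face_dim \<tau> = d - 1 \<longrightarrow> card {\<sigma>\<in>facets K. \<tau> \<subseteq> \<sigma>} \<le> 2)"

definition dual_graph :: "int \<Rightarrow> 'a set set \<Rightarrow> ('a set \<times> 'a set) set" where
  "dual_graph d K = {(\<sigma>, \<tau>). \<sigma> \<in> facets K \<and> \<tau> \<in> facets K \<and> face_dim (\<sigma> \<inter> \<tau>) = d - 1}"

definition pseudomanifold :: "int \<Rightarrow> 'a set set \<Rightarrow> bool" where
  "pseudomanifold d K \<longleftrightarrow>
     weak_pseudomanifold d K \<and> (\<forall>\<sigma>\<in>facets K. \<forall>\<tau>\<in>facets K. (\<sigma>, \<tau>) \<in> (dual_graph d K)\<^sup>*)"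


section \<open>Shelling moves\<close>

text \<open>The standard ball, on an arbitrary set of \<open>d + 1\<close> vertices.\<close>

definition standard_ball :: "int \<Rightarrow> 'a set set \<Rightarrow> bool" where
  "standard_ball d K \<longleftrightarrow> (\<exists>\<sigma>. finite \<sigma> \<and> face_dim \<sigma> = d \<and> K = face_complex \<sigma>)"

text \<open>\<open>shelling_move d \<alpha> \<beta> Y X\<close>: the complex \<open>X\<close> is obtained from \<open>Y\<close> by the move
  \<open>\<alpha> \<leadsto> \<beta>\<close>. The index of the move is \<open>face_dim \<beta>\<close>.\<close>

definition shelling_move :: "int \<Rightarrow> 'a set \<Rightarrow> 'a set \<Rightarrow> 'a set set \<Rightarrow> 'a set set \<Rightarrow> bool" where
  "shelling_move d \<alpha> \<beta> Y X \<longleftrightarrow>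
     pure_complex d X \<and> pure_complex d Y \<and>
     \<alpha> \<in> X \<and> \<beta> \<in> X \<and> \<beta> \<noteq> {} \<and> \<alpha> \<inter> \<beta> = {} \<and>
     Y \<subseteq> X \<and> facets X - facets Y = {\<alpha> \<union> \<beta>} \<and>
     induced_subcomplex Y (\<alpha> \<union> \<beta>) = join (face_complex \<alpha>) (boundary_complex \<beta>)"

definition shellable :: "int \<Rightarrow> 'a set set \<Rightarrow> bool" where
  "shellable d X \<longleftrightarrow>
     (\<exists>S. standard_ball d S \<and> (\<lambda>Y Z. \<exists>\<alpha> \<beta>. shelling_move d \<alpha> \<beta> Y Z)\<^sup>*\<^sup>* S X)"

definition k_shelled :: "int \<Rightarrow> int \<Rightarrow> 'a set set \<Rightarrow> bool" where
  "k_shelled k d X \<longleftrightarrow>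
     0 \<le> k \<and> k \<le> d \<and> pseudomanifold d X \<and>
     (\<exists>S. standard_ball d S \<and>
        (\<lambda>Y Z. \<exists>\<alpha> \<beta>. shelling_move d \<alpha> \<beta> Y Z \<and> face_dim \<beta> < k)\<^sup>*\<^sup>* S X)"


section \<open>Reduced simplicial homology with coefficients in a field\<close>

text \<open>
  Oriented simplicial chains, without choosing orientations: an \<open>n\<close>-chain is an alternating
  function on the orderings \<open>[v\<^sub>0, \<dots>, v\<^sub>n]\<close> of the \<open>n\<close>-faces, its value at an ordering being the
  coefficient of the oriented simplex \<open>[v\<^sub>0, \<dots>, v\<^sub>n]\<close>. The empty list gives the augmentation
  in degree \<open>-1\<close>. Vanishing on lists with repetitions is required separately, because in
  characteristic 2 it does not follow from the sign rule.
\<close>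

definition simplicial_chains :: "'a set set \<Rightarrow> int \<Rightarrow> ('a list \<Rightarrow> 'f::field) set" where
  "simplicial_chains K n =
     {c. (\<forall>xs. c xs \<noteq> 0 \<longrightarrow> distinct xs \<and> set xs \<in> K \<and> int (length xs) = n + 1) \<and>
         (\<forall>xs x y ys. c (xs @ x # y # ys) = - c (xs @ y # x # ys))}"

text \<open>
  The usual boundary
  \<open>\<partial>[v\<^sub>0, \<dots>, v\<^sub>n] = (\<Sum>i. (-1)\<^sup>i [v\<^sub>0, \<dots>, v\<^sub>i\<^sub>-\<^sub>1, v\<^sub>i\<^sub>+\<^sub>1, \<dots>, v\<^sub>n])\<close>, read off coefficientwise: the oriented
  simplices with \<open>[w\<^sub>1, \<dots>, w\<^sub>n]\<close> in their boundary, with sign \<open>+1\<close>, are the \<open>[v, w\<^sub>1, \<dots>, w\<^sub>n]\<close>.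
\<close>

definition chain_boundary :: "'a set set \<Rightarrow> ('a list \<Rightarrow> 'f::field) \<Rightarrow> 'a list \<Rightarrow> 'f" where
  "chain_boundary K c = (\<lambda>ws. \<Sum>v\<in>\<Union>K. c (v # ws))"

definition simplicial_cycles :: "'a set set \<Rightarrow> int \<Rightarrow> ('a list \<Rightarrow> 'f::field) set" where
  "simplicial_cycles K n = {c \<in> simplicial_chains K n. chain_boundary K c = 0}"

definition simplicial_boundaries :: "'a set set \<Rightarrow> int \<Rightarrow> ('a list \<Rightarrow> 'f::field) set" where
  "simplicial_boundaries K n = chain_boundary K ` simplicial_chains K (n + 1)"

definition homologous :: "'a set set \<Rightarrow> int \<Rightarrow> (('a list \<Rightarrow> 'f::field) \<times> ('a list \<Rightarrow> 'f)) set" where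
  "homologous K n = {(x, y). x \<in> simplicial_cycles K n \<and> y \<in> simplicial_cycles K n \<and> x - y \<in> simplicial_boundaries K n}"

definition reduced_homology :: "'a set set \<Rightarrow> int \<Rightarrow> ('a list \<Rightarrow> 'f::field) set set" where
  "reduced_homology K n = simplicial_cycles K n // homologous K n"

definition homology_trivial :: "'f::field itself \<Rightarrow> 'a set set \<Rightarrow> int \<Rightarrow> bool" where
  "homology_trivial F K n \<longleftrightarrow> is_singleton (reduced_homology K n :: ('a list \<Rightarrow> 'f) set set)"

text \<open>
  The \<open>n\<close>-th reduced homology space is isomorphic to the ground field: \<open>h\<close> is a bijection, linear
  with respect to the operations on classes induced by those on representatives.
\<close>

definition homology_line :: "'f::field itself \<Rightarrow> 'a set set \<Rightarrow> int \<Rightarrow> bool" where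
  "homology_line F K n \<longleftrightarrow>
     (\<exists>h :: 'f \<Rightarrow> ('a list \<Rightarrow> 'f) set.
        bij_betw h UNIV (reduced_homology K n) \<and>
        (\<forall>a b. \<forall>x\<in>h a. \<forall>y\<in>h b. x + y \<in> h (a + b)) \<and>
        (\<forall>r a. \<forall>x\<in>h a. (\<lambda>vs. r * x vs) \<in> h (r * a)))"

text \<open>The reduced homology of a point vanishes in all degrees.\<close>

definition homology_acyclic :: "'f::field itself \<Rightarrow> 'a set set \<Rightarrow> bool" where
  "homology_acyclic F K \<longleftrightarrow> (\<forall>n. homology_trivial F K n)"

text \<open>The reduced homology of the \<open>m\<close>-sphere is the ground field in degree \<open>m\<close>
  (for \<open>m = -1\<close>, too) and vanishes in all other degrees.\<close>

definition homology_of_sphere :: "'f::field itself \<Rightarrow> int \<Rightarrow> 'a set set \<Rightarrow> bool" where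
  "homology_of_sphere F m K \<longleftrightarrow>
     homology_line F K m \<and> (\<forall>n. n \<noteq> m \<longrightarrow> homology_trivial F K n)"


section \<open>Homology spheres, homology balls, stackedness\<close>

definition homology_sphere :: "'f::field itself \<Rightarrow> int \<Rightarrow> 'a set set \<Rightarrow> bool" where
  "homology_sphere F d K \<longleftrightarrow>
     simplicial_complex K \<and> complex_dim K = d \<and>
     (\<forall>\<sigma>\<in>K. homology_of_sphere F (d - face_dim \<sigma> - 1) (link K \<sigma>))"

definition ball_boundary :: "'f::field itself \<Rightarrow> 'a set set \<Rightarrow> 'a set set" where
  "ball_boundary F K = {\<sigma>\<in>K. homology_acyclic F (link K \<sigma>)}"

definition homology_ball :: "'f::field itself \<Rightarrow> int \<Rightarrow> 'a set set \<Rightarrow> bool" where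
  "homology_ball F d K \<longleftrightarrow>
     simplicial_complex K \<and> complex_dim K = d \<and> homology_acyclic F K \<and>
     (\<forall>\<sigma>\<in>K. \<sigma> \<noteq> {} \<longrightarrow>
        homology_of_sphere F (d - face_dim \<sigma> - 1) (link K \<sigma>) \<or> homology_acyclic F (link K \<sigma>)) \<and>
     homology_sphere F (d - 1) (ball_boundary F K)"

definition k_stacked :: "'f::field itself \<Rightarrow> int \<Rightarrow> int \<Rightarrow> 'a set set \<Rightarrow> bool" where
  "k_stacked F k d K \<longleftrightarrow>
     homology_ball F d K \<and> (\<forall>\<sigma>\<in>K. d - face_dim \<sigma> \<ge> k + 1 \<longrightarrow> \<sigma> \<in> ball_boundary F K)"

end

theory Submission
  imports Defs
begin

text \<open>
  Suppose that a small face lay inside no ridge contained in exactly one facet. The last facet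
  \<open>\<alpha> \<union> \<beta>\<close> of the shelling that contains it would then have \<open>\<alpha>\<close> inside it, which is too large
  when all indices are less than \<open>k\<close>. So the ball is stacked, as a ridge in one facet has
  a simplex as its link and hence lies in the boundary.

  Conversely, let a move \<open>\<alpha> \<leadsto> \<beta>\<close> from \<open>Y\<close> occur in a shelling of \<open>B\<close>. The links of a shellable
  complex have reduced homology only in their top degree, so the sphere \<open>\<partial>\<beta>\<close> bounds in the link of
  \<open>\<alpha>\<close> in \<open>Y\<close>. Together with \<open>\<beta>\<close>, which is not in that link, the bounding chain gives a nonzero
  cycle of top degree in the link of \<open>\<alpha>\<close> in \<open>B\<close>. Hence \<open>\<alpha>\<close> is not in the boundary, and
  \<open>k\<close>-stackedness forces \<open>\<alpha>\<close> to be large and the index \<open>dim \<beta>\<close> to be less than \<open>k\<close>.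
\<close>

section \<open>Chains and cones\<close>

lemma chainsD:
  assumes "c \<in> simplicial_chains K n" and "c xs \<noteq> 0"
  shows "distinct xs" and "set xs \<in> K" and "int (length xs) = n + 1"
  using assms unfolding simplicial_chains_def by auto

lemma chains_alternating:
  "c \<in> simplicial_chains K n \<Longrightarrow> c (xs @ x # y # ys) = - c (xs @ y # x # ys)"
  unfolding simplicial_chains_def by blast

lemma chains_alternating2:
  "c \<in> simplicial_chains K n \<Longrightarrow> c (x # y # ys) = - c (y # x # ys)"
  using chains_alternating[of c K n "[]" x y ys] by simp

lemma chainsI:
  assumes "\<And>xs. c xs \<noteq> 0 \<Longrightarrow> distinct xs \<and> set xs \<in> K \<and> int (length xs) = n + 1"
    and "\<And>xs x y ys. c (xs @ x # y # ys) = - c (xs @ y # x # ys)"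
  shows "c \<in> simplicial_chains K n"
  unfolding simplicial_chains_def
proof (rule CollectI, rule conjI)
  show "\<forall>xs. c xs \<noteq> 0 \<longrightarrow> distinct xs \<and> set xs \<in> K \<and> int (length xs) = n + 1"
    using assms(1) by blast
  show "\<forall>xs x y ys. c (xs @ x # y # ys) = - c (xs @ y # x # ys)"
    by (intro allI) (rule assms(2))
qed

lemma zero_in_chains: "0 \<in> simplicial_chains K n"
  by (rule chainsI) auto

lemma chains_diff:
  assumes "c \<in> simplicial_chains K n" and "e \<in> simplicial_chains K n"
  shows "c - e \<in> simplicial_chains K n"
proof (rule chainsI)
  fix xs assume "(c - e) xs \<noteq> 0"
  then have "c xs \<noteq> 0 \<or> e xs \<noteq> 0" by auto
  then show "distinct xs \<and> set xs \<in> K \<and> int (length xs) = n + 1"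
    using chainsD[OF assms(1)] chainsD[OF assms(2)] by blast
next
  fix xs x y ys
  show "(c - e) (xs @ x # y # ys) = - (c - e) (xs @ y # x # ys)"
    using chains_alternating[OF assms(1), of xs x y ys] chains_alternating[OF assms(2), of xs x y ys]
    by simp
qed

lemma chains_restrict:
  assumes "c \<in> simplicial_chains K n" and "\<And>xs. c xs \<noteq> 0 \<Longrightarrow> set xs \<in> L"
  shows "c \<in> simplicial_chains L n"
proof (rule chainsI)
  show "distinct xs \<and> set xs \<in> L \<and> int (length xs) = n + 1" if "c xs \<noteq> 0" for xs
    using assms(2)[OF that] chainsD[OF assms(1) that] by blast
  show "c (xs @ x # y # ys) = - c (xs @ y # x # ys)" for xs x y ys
    by (rule chains_alternating[OF assms(1)])
qed

lemma chains_mono: "L \<subseteq> K \<Longrightarrow> simplicial_chains L n \<subseteq> simplicial_chains K n"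
  by (auto intro: chains_restrict dest: chainsD(2))

text \<open>Each of the \<open>length us\<close> transpositions carrying \<open>v\<close> to the
  front changes the sign. Vanishing can thus be tested with \<open>v\<close> in front, where
  \<open>cone\<close> is explicit.\<close>

lemma alternating_front:
  assumes "c \<in> simplicial_chains K n"
  shows "c (us @ v # ws) = (- 1) ^ length us * c (v # us @ ws)"
proof (induction us arbitrary: ws rule: rev_induct)
  case (snoc u us)
  have "c ((us @ [u]) @ v # ws) = - c (us @ v # u # ws)"
    using chains_alternating[OF assms, of us u v ws] by simp
  then show ?case using snoc[of "u # ws"] by simp
qed simp

text \<open>Vertices outside \<open>K\<close> contribute zero because chains vanish off
  \<open>K\<close>. Hence boundaries taken in a subcomplex and in the whole complex agree.\<close>

lemma chain_boundary_eq:
  assumes "c \<in> simplicial_chains K n" and "\<Union>K \<subseteq> V" and "finite V"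
  shows "chain_boundary K c = (\<lambda>ws. \<Sum>v\<in>V. c (v # ws))"
proof
  fix ws
  have "c (v # ws) = 0" if "v \<notin> \<Union>K" for v
    using chainsD(2)[OF assms(1), of "v # ws"] that by force
  then show "chain_boundary K c ws = (\<Sum>v\<in>V. c (v # ws))"
    unfolding chain_boundary_def using assms by (intro sum.mono_neutral_left) auto
qed

lemma chain_boundary_subcomplex:
  assumes "c \<in> simplicial_chains L n" and "L \<subseteq> K" and "finite (\<Union>K)"
  shows "chain_boundary L c = chain_boundary K c"
  using chain_boundary_eq[OF assms(1) Union_mono[OF assms(2)] assms(3)]
  by (simp add: chain_boundary_def)

lemma chain_boundary_diff:
  "chain_boundary K (c - e) = chain_boundary K c - chain_boundary K e"
  unfolding chain_boundary_def by (auto simp: sum_subtractf)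

lemma chain_boundary_in_chains:
  assumes "c \<in> simplicial_chains K (n + 1)" and "\<And>\<sigma> \<tau>. \<sigma> \<in> K \<Longrightarrow> \<tau> \<subseteq> \<sigma> \<Longrightarrow> \<tau> \<in> K"
  shows "chain_boundary K c \<in> simplicial_chains K n"
proof (rule chainsI)
  fix xs assume "chain_boundary K c xs \<noteq> 0"
  then obtain v where v: "c (v # xs) \<noteq> 0"
    unfolding chain_boundary_def by (meson sum.not_neutral_contains_not_neutral)
  have "set xs \<in> K"
    using assms(2)[OF chainsD(2)[OF assms(1) v], of "set xs"] by auto
  then show "distinct xs \<and> set xs \<in> K \<and> int (length xs) = n + 1"
    using chainsD(1,3)[OF assms(1) v] by simp
next
  fix xs x y ys
  have "c (v # xs @ x # y # ys) = - c (v # xs @ y # x # ys)" for v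
    using chains_alternating[OF assms(1), of "v # xs" x y ys] by (simp only: append_Cons)
  then show "chain_boundary K c (xs @ x # y # ys) = - chain_boundary K c (xs @ y # x # ys)"
    unfolding chain_boundary_def by (simp only: sum_negf)
qed

text \<open>In characteristic 2 antisymmetry alone would not suffice, hence the diagonal hypothesis.\<close>

lemma sum_antisymmetric:
  fixes f :: "'a \<Rightarrow> 'a \<Rightarrow> 'b::ab_group_add"
  assumes "finite V" and "\<And>x y. f x y = - f y x" and "\<And>x. f x x = 0"
  shows "(\<Sum>x\<in>V. \<Sum>y\<in>V. f x y) = 0"
  using assms(1)
proof (induction V rule: finite_induct)
  case (insert a V)
  have "(\<Sum>x\<in>V. f x a) = - (\<Sum>x\<in>V. f a x)"
    unfolding sum_negf[symmetric] by (intro sum.cong refl) (rule assms(2))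
  then show ?case
    using insert assms(3) by (simp add: sum.distrib)
qed simp

text \<open>The two added vertices enter antisymmetrically, and on the diagonal the list has a
  repetition.\<close>

lemma chain_boundary_boundary:
  assumes "c \<in> simplicial_chains K n" and "finite (\<Union>K)"
  shows "chain_boundary K (chain_boundary K c) = 0"
proof
  fix ws
  have "c (x # x # ws) = 0" for x
    using chainsD(1)[OF assms(1), of "x # x # ws"] by auto
  then show "chain_boundary K (chain_boundary K c) ws = 0 ws"
    unfolding chain_boundary_def zero_fun_apply
    by (intro sum_antisymmetric[OF assms(2)] chains_alternating2[OF assms(1)])
qed

text \<open>The sign in the recursion moves \<open>v\<close> to the front; \<open>cone v c\<close> is alternating only if \<open>c\<close> vanishes
  on all simplices containing \<open>v\<close>.\<close>

fun cone :: "'a \<Rightarrow> ('a list \<Rightarrow> 'f::field) \<Rightarrow> 'a list \<Rightarrow> 'f" where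
  "cone v c [] = 0"
| "cone v c (x # xs) = (if x = v then c xs else - cone v (\<lambda>ys. c (x # ys)) xs)"

lemma cone_nonzero:
  "cone v c xs \<noteq> 0 \<Longrightarrow> \<exists>us ws. xs = us @ v # ws \<and> c (us @ ws) \<noteq> 0"
proof (induction xs arbitrary: c)
  case (Cons x xs)
  show ?case
  proof (cases "x = v")
    case True
    then have "x # xs = [] @ v # xs \<and> c ([] @ xs) \<noteq> 0" using Cons.prems by simp
    then show ?thesis by blast
  next
    case False
    then have "cone v (\<lambda>ys. c (x # ys)) xs \<noteq> 0" using Cons.prems by auto
    then obtain us ws where "xs = us @ v # ws" and "c (x # us @ ws) \<noteq> 0"
      using Cons.IH by blast
    then show ?thesis by (intro exI[of _ "x # us"] exI[of _ ws]) auto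
  qed
qed simp

lemma cone_zero: "cone v (\<lambda>_. 0) xs = 0"
  using cone_nonzero by metis

lemma cone_uminus: "cone v (\<lambda>ys. - c ys) xs = - cone v c xs"
  by (induction xs arbitrary: c) auto

lemma cone_add: "cone v (\<lambda>ys. c ys + e ys) xs = cone v c xs + cone v e xs"
  by (induction xs arbitrary: c e) auto

lemma cone_sum: "finite V \<Longrightarrow> cone v (\<lambda>ys. \<Sum>x\<in>V. c x ys) xs = (\<Sum>x\<in>V. cone v (c x) xs)"
  by (induction V rule: finite_induct) (auto simp: cone_zero cone_add)

text \<open>Swapping \<open>v\<close> with a neighbour shifts its position by one and so flips the
  sign in the recursion; other swaps use the sign rule of \<open>c\<close>. If both swapped entries
  are \<open>v\<close>, both sides vanish by the second assumption.\<close>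

lemma cone_alternating:
  assumes "\<And>xs x y ys. c (xs @ x # y # ys) = - c (xs @ y # x # ys)"
    and "\<And>xs. v \<in> set xs \<Longrightarrow> c xs = 0"
  shows "cone v c (xs @ x # y # ys) = - cone v c (xs @ y # x # ys)"
  using assms
proof (induction xs arbitrary: c)
  case Nil
  have "(\<lambda>zs. c (x # y # zs)) = (\<lambda>zs. - c (y # x # zs))"
    using Nil(1)[of "[]" x y] by (intro ext) (simp only: append_Nil)
  then have "cone v (\<lambda>zs. c (x # y # zs)) ys = - cone v (\<lambda>zs. c (y # x # zs)) ys"
    by (simp add: cone_uminus)
  then show ?case using Nil(2) by auto
next
  case (Cons u us)
  have "cone v (\<lambda>zs. c (u # zs)) (us @ x # y # ys) = - cone v (\<lambda>zs. c (u # zs)) (us @ y # x # ys)"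
  proof (rule Cons.IH)
    show "c (u # xs @ x # y # ys) = - c (u # xs @ y # x # ys)" for xs x y ys
      using Cons.prems(1)[of "u # xs" x y ys] by (simp only: append_Cons)
    show "c (u # xs) = 0" if "v \<in> set xs" for xs
      using Cons.prems(2) that by simp
  qed
  then show ?case using Cons.prems(1)[of us x y ys] by simp
qed

lemma cone_in_chains:
  assumes "c \<in> simplicial_chains K n"
    and "\<And>xs. c xs \<noteq> 0 \<Longrightarrow> v \<notin> set xs \<and> insert v (set xs) \<in> L"
  shows "cone v c \<in> simplicial_chains L (n + 1)"
proof (rule chainsI)
  fix xs assume "cone v c xs \<noteq> 0"
  from cone_nonzero[OF this] obtain us ws
    where xs: "xs = us @ v # ws" and nz: "c (us @ ws) \<noteq> 0" by blast
  show "distinct xs \<and> set xs \<in> L \<and> int (length xs) = n + 1 + 1"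
    using assms(2)[OF nz] chainsD[OF assms(1) nz] unfolding xs by auto
next
  fix xs x y ys
  show "cone v c (xs @ x # y # ys) = - cone v c (xs @ y # x # ys)"
  proof (rule cone_alternating)
    show "c (xs @ x # y # ys) = - c (xs @ y # x # ys)" for xs x y ys
      by (rule chains_alternating[OF assms(1)])
  qed (use assms(2) in blast)
qed

text \<open>This is the homotopy identity: the boundary of a cone is the chain minus the cone over
  its boundary. The summand at \<open>x = v\<close> gives \<open>c ws\<close>, the others carry the
  sign of the recursion.\<close>

lemma sum_cone:
  assumes "finite V" and "v \<in> V" and "\<And>xs. v \<in> set xs \<Longrightarrow> c xs = 0"
  shows "(\<Sum>x\<in>V. cone v c (x # ws)) = c ws - cone v (\<lambda>ys. \<Sum>x\<in>V. c (x # ys)) ws"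
proof -
  have "cone v (\<lambda>ys. c (v # ys)) ws = 0" using assms(3) by (simp add: cone_zero)
  then have "cone v (\<lambda>ys. \<Sum>x\<in>V. c (x # ys)) ws = (\<Sum>x\<in>V - {v}. cone v (\<lambda>ys. c (x # ys)) ws)"
    using assms(1,2) by (simp add: cone_sum sum.remove[of V v] cone_add)
  moreover have "(\<Sum>x\<in>V. cone v c (x # ws)) = c ws + (\<Sum>x\<in>V - {v}. - cone v (\<lambda>ys. c (x # ys)) ws)"
    using assms(1,2) by (simp add: sum.remove[of V v])
  ultimately show ?thesis by (simp add: sum_negf)
qed

text \<open>Iterated coning over the vertices yields a fundamental chain of the simplex;
  \<open>{\<beta>}\<close> serves only to record its support.\<close>

lemma simplex_chain:
  assumes "finite \<beta>"
  shows "\<exists>c \<in> simplicial_chains {\<beta>} (face_dim \<beta>). \<exists>xs. c xs \<noteq> (0::'f::field)"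
  using assms
proof (induction \<beta> rule: finite_induct)
  case empty
  have "(\<lambda>xs. if xs = [] then 1 else 0 :: 'f) \<in> simplicial_chains {{}} (face_dim {})"
    by (rule chainsI) (auto simp: face_dim_def split: if_splits)
  then show ?case by (rule bexI[rotated]) auto
next
  case (insert v \<beta>)
  then obtain c :: "'a list \<Rightarrow> 'f" and xs
    where c: "c \<in> simplicial_chains {\<beta>} (face_dim \<beta>)" and xs: "c xs \<noteq> 0" by blast
  have "cone v c \<in> simplicial_chains {insert v \<beta>} (face_dim \<beta> + 1)"
  proof (rule cone_in_chains[OF c])
    fix ys assume "c ys \<noteq> 0"
    then show "v \<notin> set ys \<and> insert v (set ys) \<in> {insert v \<beta>}"
      using chainsD(2)[OF c] insert.hyps by auto
  qed
  moreover have "cone v c (v # xs) \<noteq> 0" using xs by simp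
  moreover have "face_dim \<beta> + 1 = face_dim (insert v \<beta>)" using insert.hyps by (simp add: face_dim_def)
  ultimately show ?case by metis
qed

section \<open>Acyclicity of links in shellable complexes\<close>

lemma boundaries_mono:
  assumes "L \<subseteq> K" and "finite (\<Union>K)"
  shows "simplicial_boundaries L n \<subseteq> simplicial_boundaries K n"
proof
  fix z :: "'a list \<Rightarrow> 'b"
  assume "z \<in> simplicial_boundaries L n"
  then obtain c where c: "c \<in> simplicial_chains L (n + 1)" and z: "z = chain_boundary L c"
    unfolding simplicial_boundaries_def by (rule imageE)
  show "z \<in> simplicial_boundaries K n"
    unfolding simplicial_boundaries_def z chain_boundary_subcomplex[OF c assms]
    using chains_mono[OF assms(1)] c by (intro imageI) (rule subsetD)
qed

text \<open>If \<open>\<beta> \<noteq> \<gamma>\<close>, the chain complex of the new faces is contracted by the cone over any vertex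
  of \<open>\<gamma> - \<beta>\<close>; if \<open>\<beta> = \<gamma>\<close>, there is only one new face, of too large a dimension to matter.\<close>

lemma cycles_bound_extend:
  fixes K L :: "'a set set"
  assumes K: "K = L \<union> {\<tau>. \<beta> \<subseteq> \<tau> \<and> \<tau> \<subseteq> \<gamma>}"
    and L: "\<And>\<tau>. \<tau> \<in> L \<Longrightarrow> \<not> \<beta> \<subseteq> \<tau>"
    and sub: "\<beta> \<subseteq> \<gamma>"
    and fin: "finite (\<Union>K)"
    and down: "\<And>\<sigma> \<tau>. \<sigma> \<in> K \<Longrightarrow> \<tau> \<subseteq> \<sigma> \<Longrightarrow> \<tau> \<in> K"
    and n: "\<beta> \<noteq> \<gamma> \<or> n + 1 < int (card \<gamma>)"
    and IH: "(simplicial_cycles L n :: ('a list \<Rightarrow> 'f::field) set) \<subseteq> simplicial_boundaries L n"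
  shows "(simplicial_cycles K n :: ('a list \<Rightarrow> 'f::field) set) \<subseteq> simplicial_boundaries K n"
proof
  fix z :: "'a list \<Rightarrow> 'f"
  assume "z \<in> simplicial_cycles K n"
  then have z: "z \<in> simplicial_chains K n" and z0: "chain_boundary K z = 0"
    unfolding simplicial_cycles_def by auto
  have LK: "L \<subseteq> K" using K by blast
  \<comment> \<open>It suffices to match \<open>z\<close> on the new faces by the boundary of some
    \<open>w\<close>: the difference is a cycle of \<open>L\<close>, bounds by \<open>IH\<close>,
    and its filling added to \<open>w\<close> fills \<open>z\<close>.\<close>
  have bound: "z \<in> simplicial_boundaries K n"
    if w: "w \<in> simplicial_chains K (n + 1)"
      and zw: "\<And>xs. \<beta> \<subseteq> set xs \<Longrightarrow> set xs \<subseteq> \<gamma> \<Longrightarrow> (z - chain_boundary K w) xs = 0" for w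
  proof -
    have zK: "z - chain_boundary K w \<in> simplicial_chains K n"
      by (intro chains_diff[OF z] chain_boundary_in_chains[OF w]) (rule down)
    have zL: "z - chain_boundary K w \<in> simplicial_chains L n"
      by (rule chains_restrict[OF zK]) (use chainsD(2)[OF zK] zw K in blast)
    have "chain_boundary L (z - chain_boundary K w) = 0"
      using chain_boundary_subcomplex[OF zL LK fin] z0 chain_boundary_boundary[OF w fin]
      by (simp add: chain_boundary_diff)
    with zL IH have "z - chain_boundary K w \<in> simplicial_boundaries L n"
      unfolding simplicial_cycles_def by blast
    then have "z - chain_boundary K w \<in> simplicial_boundaries K n"
      using boundaries_mono[OF LK fin] by blast
    then obtain u where u: "u \<in> simplicial_chains K (n + 1)"
      and uz: "z - chain_boundary K w = chain_boundary K u"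
      unfolding simplicial_boundaries_def by blast
    have "w - (0 - u) \<in> simplicial_chains K (n + 1)"
      by (intro chains_diff zero_in_chains u w)
    moreover have "chain_boundary K (w - (0 - u)) = z"
    proof -
      have "chain_boundary K 0 = (0 :: 'a list \<Rightarrow> 'f)" by (auto simp: chain_boundary_def)
      then show ?thesis
        unfolding chain_boundary_diff uz[symmetric] by (auto simp: fun_eq_iff)
    qed
    ultimately show ?thesis unfolding simplicial_boundaries_def by blast
  qed
  show "z \<in> simplicial_boundaries K n"
  proof (cases "\<beta> = \<gamma>")
    case True
    show ?thesis
    proof (rule bound[OF zero_in_chains])
      fix xs assume "\<beta> \<subseteq> set xs" and "set xs \<subseteq> \<gamma>"
      then have "set xs = \<gamma>" using True by auto
      have "z xs = 0"
      proof (rule ccontr)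
        assume "z xs \<noteq> 0"
        with \<open>set xs = \<gamma>\<close> have "int (card \<gamma>) = n + 1"
          using chainsD(1,3)[OF z, of xs] distinct_card[of xs] by auto
        then show False using n True by auto
      qed
      then show "(z - chain_boundary K 0) xs = 0" by (simp add: chain_boundary_def)
    qed
  next
    case False
    then obtain v where v: "v \<in> \<gamma>" "v \<notin> \<beta>" using sub by blast
    have \<gamma>K: "\<gamma> \<in> K" using K sub by blast
    \<comment> \<open>\<open>c\<close> keeps \<open>z\<close> on the new faces avoiding
      \<open>v\<close>; coning adds \<open>v\<close> without leaving the interval from
      \<open>\<beta>\<close> to \<open>\<gamma>\<close>.\<close>
    define c where "c = (\<lambda>xs. if \<beta> \<subseteq> set xs \<and> set xs \<subseteq> \<gamma> - {v} then z xs else 0)"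
    have c: "c \<in> simplicial_chains K n"
    proof (rule chainsI)
      fix xs assume "c xs \<noteq> 0"
      then have "z xs \<noteq> 0" by (auto simp: c_def split: if_splits)
      then show "distinct xs \<and> set xs \<in> K \<and> int (length xs) = n + 1"
        using chainsD[OF z] by blast
    next
      fix xs ys and x y :: 'a
      have "set (xs @ x # y # ys) = set (xs @ y # x # ys)" by auto
      then show "c (xs @ x # y # ys) = - c (xs @ y # x # ys)"
        unfolding c_def by (simp only: chains_alternating[OF z, of xs x y ys] if_distrib[of uminus] minus_zero)
    qed
    have cv: "c xs = 0" if "v \<in> set xs" for xs using that by (auto simp: c_def)
    have w: "cone v c \<in> simplicial_chains K (n + 1)"
    proof (rule cone_in_chains[OF c])
      fix xs assume "c xs \<noteq> 0"
      then show "v \<notin> set xs \<and> insert v (set xs) \<in> K"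
        using K v by (auto simp: c_def split: if_splits)
    qed
    have vK: "v \<in> \<Union>K" using \<gamma>K v by blast
    have bw: "chain_boundary K (cone v c) ws = c ws - cone v (\<lambda>ys. \<Sum>x\<in>\<Union>K. c (x # ys)) ws" for ws
      unfolding chain_boundary_def using sum_cone[OF fin vK cv] by simp
    have zwK: "z - chain_boundary K (cone v c) \<in> simplicial_chains K n"
      by (intro chains_diff[OF z] chain_boundary_in_chains[OF w]) (rule down)
    show ?thesis
    proof (rule bound[OF w])
      fix xs assume xs: "\<beta> \<subseteq> set xs" "set xs \<subseteq> \<gamma>"
      show "(z - chain_boundary K (cone v c)) xs = 0"
      proof (cases "v \<in> set xs")
        case False
        then have "c xs = z xs" using xs by (auto simp: c_def)
        moreover have "cone v (\<lambda>ys. \<Sum>x\<in>\<Union>K. c (x # ys)) xs = 0"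
          using cone_nonzero[of v _ xs] False by fastforce
        ultimately show ?thesis by (simp add: bw)
      next
        case True
        then obtain us ws where uw: "xs = us @ v # ws" by (meson split_list)
        define ys where "ys = us @ ws"
        \<comment> \<open>For \<open>v\<close> not in \<open>ys\<close>, the cone boundary at
          \<open>v # ys\<close> is minus the sum of \<open>z (x # ys)\<close> over
          \<open>x \<noteq> v\<close>, and this equals \<open>z (v # ys)\<close> because
          \<open>z\<close> is a cycle.\<close>
        have "(z - chain_boundary K (cone v c)) (v # ys) = 0"
        proof (cases "v \<in> set ys")
          case True
          then have "\<not> distinct (v # ys)" by auto
          then show ?thesis using chainsD(1)[OF zwK] by blast
        next
          case False
          have \<beta>: "\<beta> \<subseteq> set ys" and \<gamma>: "set ys \<subseteq> \<gamma> - {v}"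
            using xs v uw False unfolding ys_def by auto
          have eq: "c (x # ys) = z (x # ys)" if "x \<noteq> v" for x
          proof (cases "x \<in> \<gamma>")
            case True
            then show ?thesis using \<beta> \<gamma> that by (auto simp: c_def)
          next
            case False
            \<comment> \<open>The set contains \<open>\<beta>\<close>, so it is no face of
              \<open>L\<close>; it leaves \<open>\<gamma>\<close>, so it is no new face
              either.\<close>
            then have "set (x # ys) \<notin> K" using K L[of "set (x # ys)"] \<beta> by auto
            then show ?thesis using chainsD(2)[OF z] chainsD(2)[OF c] by metis
          qed
          have "(\<Sum>x\<in>\<Union>K. c (x # ys)) = (\<Sum>x\<in>\<Union>K - {v}. z (x # ys))"
            using sum.remove[OF fin vK, of "\<lambda>x. c (x # ys)"] cv[of "v # ys"] eq by simp
          moreover have "z (v # ys) + (\<Sum>x\<in>\<Union>K - {v}. z (x # ys)) = 0"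
            using fun_cong[OF z0, of ys] sum.remove[OF fin vK, of "\<lambda>x. z (x # ys)"]
            by (simp add: chain_boundary_def)
          ultimately show ?thesis
            using cv[of "v # ys"] by (simp add: bw)
        qed
        then show ?thesis
          using alternating_front[OF zwK, of us v ws] unfolding uw ys_def by simp
      qed
    qed
  qed
qed

section \<open>Links and facets of pure complexes\<close>

lemma simplicial_complex_finite_Union: "simplicial_complex K \<Longrightarrow> finite (\<Union>K)"
  unfolding simplicial_complex_def by auto

lemma simplicial_complex_subset:
  "simplicial_complex K \<Longrightarrow> \<sigma> \<in> K \<Longrightarrow> \<tau> \<subseteq> \<sigma> \<Longrightarrow> \<tau> \<in> K"
  unfolding simplicial_complex_def by blast

lemma link_finite_Union: "simplicial_complex K \<Longrightarrow> finite (\<Union>(link K \<sigma>))"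
  by (rule finite_subset[OF _ simplicial_complex_finite_Union[of K]]) (auto simp: link_def)

lemma link_subset:
  assumes "simplicial_complex K" "\<rho> \<in> link K \<sigma>" "\<tau> \<subseteq> \<rho>"
  shows "\<tau> \<in> link K \<sigma>"
  using assms simplicial_complex_subset[OF assms(1), of "\<sigma> \<union> \<rho>" "\<sigma> \<union> \<tau>"]
  unfolding link_def by blast

lemma exists_facet:
  assumes "simplicial_complex K" and "\<sigma> \<in> K"
  shows "\<exists>\<tau>\<in>facets K. \<sigma> \<subseteq> \<tau>"
proof -
  have "finite K" using assms(1) unfolding simplicial_complex_def by blast
  from finite_has_maximal2[OF this assms(2)]
  obtain \<tau> where "\<tau> \<in> K" "\<sigma> \<subseteq> \<tau>" "\<forall>\<rho>\<in>K. \<tau> \<subseteq> \<rho> \<longrightarrow> \<tau> = \<rho>" by blast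
  then show ?thesis unfolding facets_def by blast
qed

lemma pure_card:
  assumes "pure_complex d K"
  shows "\<sigma> \<in> facets K \<Longrightarrow> int (card \<sigma>) = d + 1"
    and "\<sigma> \<in> K \<Longrightarrow> int (card \<sigma>) \<le> d + 1"
    and "\<sigma> \<in> K \<Longrightarrow> int (card \<sigma>) = d + 1 \<Longrightarrow> \<sigma> \<in> facets K"
proof -
  have d: "int (card \<sigma>) = d + 1" if "\<sigma> \<in> facets K" for \<sigma>
    using assms that unfolding pure_complex_def face_dim_def by auto
  then show "\<sigma> \<in> facets K \<Longrightarrow> int (card \<sigma>) = d + 1" .
  have sc: "simplicial_complex K" using assms unfolding pure_complex_def by blast
  have fin: "finite \<tau>" if "\<tau> \<in> facets K" for \<tau>
    using that sc unfolding facets_def simplicial_complex_def by simp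
  show "int (card \<sigma>) \<le> d + 1" if \<sigma>: "\<sigma> \<in> K"
  proof -
    obtain \<tau> where \<tau>: "\<tau> \<in> facets K" "\<sigma> \<subseteq> \<tau>" using exists_facet[OF sc \<sigma>] by blast
    then show ?thesis using d[OF \<tau>(1)] card_mono[OF fin[OF \<tau>(1)] \<tau>(2)] by simp
  qed
  show "\<sigma> \<in> facets K" if \<sigma>: "\<sigma> \<in> K" "int (card \<sigma>) = d + 1"
  proof -
    obtain \<tau> where \<tau>: "\<tau> \<in> facets K" "\<sigma> \<subseteq> \<tau>" using exists_facet[OF sc \<sigma>(1)] by blast
    then have "\<sigma> = \<tau>" using d[OF \<tau>(1)] \<sigma>(2) card_subset_eq[OF fin[OF \<tau>(1)] \<tau>(2)] by simp
    then show ?thesis using \<tau>(1) by simp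
  qed
qed

lemma standard_ball_pure: "standard_ball d S \<Longrightarrow> pure_complex d S"
  unfolding standard_ball_def pure_complex_def simplicial_complex_def facets_def face_complex_def
  by (auto intro: finite_subset)

section \<open>Combinatorics of a single shelling move\<close>

locale shelling_step =
  fixes d :: int and \<alpha> \<beta> :: "'a set" and Y X :: "'a set set"
  assumes move: "shelling_move d \<alpha> \<beta> Y X"
begin

lemma pure: "pure_complex d X" "pure_complex d Y"
  and sub: "Y \<subseteq> X" and nonempty: "\<beta> \<noteq> {}" and disj: "\<alpha> \<inter> \<beta> = {}"
  and complex: "simplicial_complex X" "simplicial_complex Y"
  using move unfolding shelling_move_def pure_complex_def by auto

lemma new_facet: "\<alpha> \<union> \<beta> \<in> facets X" "\<alpha> \<union> \<beta> \<notin> facets Y"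
  using move unfolding shelling_move_def by auto

lemma finite_new: "finite \<alpha>" "finite \<beta>"
  using new_facet complex unfolding facets_def simplicial_complex_def by auto

lemma card_new: "int (card \<alpha>) + int (card \<beta>) = d + 1"
  using pure_card(1)[OF pure(1) new_facet(1)] finite_new disj by (simp add: card_Un_disjoint)

text \<open>By purity, facets are the faces of full size, so no old facet is absorbed into a larger
  face. The definition of a move only controls the facets gained.\<close>

lemma facets_eq: "facets X = insert (\<alpha> \<union> \<beta>) (facets Y)"
proof -
  have "\<sigma> \<in> facets X" if "\<sigma> \<in> facets Y" for \<sigma>
  proof (rule pure_card(3)[OF pure(1)])
    show "\<sigma> \<in> X" using that sub unfolding facets_def by blast
  qed (rule pure_card(1)[OF pure(2) that])
  moreover have "facets X - facets Y = {\<alpha> \<union> \<beta>}"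
    using move unfolding shelling_move_def by blast
  ultimately show ?thesis by blast
qed

text \<open>A subset of the new facet splits into its parts in \<open>\<alpha>\<close> and in
  \<open>\<beta>\<close>; membership in the join demands that the second part be proper.\<close>

lemma old_face:
  assumes "\<tau> \<subseteq> \<alpha> \<union> \<beta>"
  shows "\<tau> \<in> Y \<longleftrightarrow> \<not> \<beta> \<subseteq> \<tau>"
proof -
  have eq: "induced_subcomplex Y (\<alpha> \<union> \<beta>) = join (face_complex \<alpha>) (boundary_complex \<beta>)"
    using move unfolding shelling_move_def by blast
  have "\<tau> \<in> Y \<longleftrightarrow> \<tau> \<in> join (face_complex \<alpha>) (boundary_complex \<beta>)"
    unfolding eq[symmetric] induced_subcomplex_def using assms by blast
  also have "\<dots> \<longleftrightarrow> \<not> \<beta> \<subseteq> \<tau>"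
  proof
    assume "\<tau> \<in> join (face_complex \<alpha>) (boundary_complex \<beta>)"
    then show "\<not> \<beta> \<subseteq> \<tau>"
      unfolding join_def face_complex_def boundary_complex_def using disj by blast
  next
    assume "\<not> \<beta> \<subseteq> \<tau>"
    then have "\<tau> = (\<tau> \<inter> \<alpha>) \<union> (\<tau> \<inter> \<beta>)" "\<tau> \<inter> \<alpha> \<subseteq> \<alpha>" "\<tau> \<inter> \<beta> \<subset> \<beta>" using assms by blast+
    then show "\<tau> \<in> join (face_complex \<alpha>) (boundary_complex \<beta>)"
      unfolding join_def face_complex_def boundary_complex_def by blast
  qed
  finally show ?thesis .
qed

lemma not_old: "\<tau> \<in> Y \<Longrightarrow> \<not> \<beta> \<subseteq> \<tau>"
  using old_face[of \<beta>] simplicial_complex_subset[OF complex(2)] by blast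

text \<open>A face of \<open>X\<close> lies in an old facet or in the new one, and
  \<open>old_face\<close> settles the latter. The added faces form an interval, as
  \<open>cycles_bound_extend\<close> requires.\<close>

lemma faces_eq: "X = Y \<union> {\<tau>. \<beta> \<subseteq> \<tau> \<and> \<tau> \<subseteq> \<alpha> \<union> \<beta>}"
proof -
  have "\<tau> \<in> Y \<or> \<beta> \<subseteq> \<tau> \<and> \<tau> \<subseteq> \<alpha> \<union> \<beta>" if \<tau>: "\<tau> \<in> X" for \<tau>
  proof -
    obtain \<sigma> where \<sigma>: "\<sigma> \<in> facets X" "\<tau> \<subseteq> \<sigma>" using exists_facet[OF complex(1) \<tau>] by blast
    then consider "\<sigma> \<in> Y" | "\<sigma> = \<alpha> \<union> \<beta>" unfolding facets_eq by (auto simp: facets_def)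
    then show ?thesis
      using \<sigma>(2) old_face simplicial_complex_subset[OF complex(2)] by cases blast+
  qed
  moreover have "\<tau> \<in> X" if "\<tau> \<subseteq> \<alpha> \<union> \<beta>" for \<tau>
    using simplicial_complex_subset[OF complex(1) _ that] new_facet(1) unfolding facets_def by blast
  ultimately show ?thesis using sub by blast
qed

end

section \<open>Homology of links along a shelling\<close>

abbreviation shells_to :: "int \<Rightarrow> 'a set set \<Rightarrow> 'a set set \<Rightarrow> bool" where
  "shells_to d \<equiv> (\<lambda>Y Z. \<exists>\<alpha> \<beta>. shelling_move d \<alpha> \<beta> Y Z)\<^sup>*\<^sup>*"

text \<open>The empty family arises as the link of a non-face. It lacks even the empty face, so its
  only chain is zero.\<close>

lemma cycles_bound_empty:
  "(simplicial_cycles {} n :: ('a list \<Rightarrow> 'f::field) set) \<subseteq> simplicial_boundaries {} n"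
proof
  fix z :: "'a list \<Rightarrow> 'f"
  assume "z \<in> simplicial_cycles {} n"
  then have "z xs = 0" for xs unfolding simplicial_cycles_def simplicial_chains_def by auto
  then have "z = chain_boundary {} 0" by (auto simp: chain_boundary_def)
  then show "z \<in> simplicial_boundaries {} n"
    unfolding simplicial_boundaries_def using zero_in_chains by blast
qed

text \<open>All faces of \<open>\<gamma>\<close> are added at once to the empty family, as an
  interval with least element \<open>{}\<close>. For \<open>\<gamma> = {}\<close> degree
  \<open>-1\<close> must be excluded, since there the empty face is a cycle that does not
  bound.\<close>

lemma cycles_bound_simplex:
  assumes "finite \<gamma>" and "\<gamma> \<noteq> {} \<or> n < - 1"
  shows "(simplicial_cycles (face_complex \<gamma>) n :: ('a list \<Rightarrow> 'f::field) set)
           \<subseteq> simplicial_boundaries (face_complex \<gamma>) n"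
proof (rule cycles_bound_extend[where L = "{}" and \<beta> = "{}" and \<gamma> = \<gamma>])
  have "\<Union>(face_complex \<gamma>) = \<gamma>" unfolding face_complex_def by blast
  then show "finite (\<Union>(face_complex \<gamma>))" using assms(1) by simp
qed (use assms cycles_bound_empty in \<open>auto simp: face_complex_def\<close>)

text \<open>The link of a face \<open>\<alpha>\<close> has dimension
  \<open>d - card \<alpha>\<close>, so the degree \<open>n\<close> is below the top. Each move
  leaves the link unchanged or adds an interval of faces to it.\<close>

lemma shelled_link_cycles_bound:
  assumes "standard_ball d S" and "shells_to d S Y" and "n + 1 + int (card \<alpha>) \<le> d"
  shows "(simplicial_cycles (link Y \<alpha>) n :: ('a list \<Rightarrow> 'f::field) set)
           \<subseteq> simplicial_boundaries (link Y \<alpha>) n"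
  using assms(2)
proof (induction rule: rtranclp_induct)
  case base
  obtain \<sigma> where \<sigma>: "finite \<sigma>" "face_dim \<sigma> = d" "S = face_complex \<sigma>"
    using assms(1) unfolding standard_ball_def by blast
  show ?case
  proof (cases "\<alpha> \<subseteq> \<sigma>")
    case True
    then have "link S \<alpha> = face_complex (\<sigma> - \<alpha>)"
      unfolding \<sigma> link_def face_complex_def by blast
    \<comment> \<open>If \<open>\<alpha> = \<sigma>\<close>, then
      \<open>card \<alpha> = d + 1\<close> and the degree bound gives
      \<open>n \<le> -2\<close>.\<close>
    moreover have "\<sigma> - \<alpha> \<noteq> {} \<or> n < - 1"
      using True \<sigma> assms(3) unfolding face_dim_def by force
    ultimately show ?thesis using cycles_bound_simplex[of "\<sigma> - \<alpha>"] \<sigma> by simp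
  next
    case False
    then have "link S \<alpha> = {}" unfolding \<sigma> link_def face_complex_def by blast
    then show ?thesis using cycles_bound_empty by simp
  qed
next
  case (step Y X)
  from step.hyps(2) obtain \<alpha>' \<beta> where "shelling_move d \<alpha>' \<beta> Y X" by blast
  then interpret shelling_step d \<alpha>' \<beta> Y X by unfold_locales
  show ?case
  proof (cases "\<alpha> \<subseteq> \<alpha>' \<union> \<beta>")
    case False
    then have "link X \<alpha> = link Y \<alpha>" unfolding link_def by (subst faces_eq) blast
    then show ?thesis using step.IH by simp
  next
    case True
    have card: "int (card (\<alpha>' \<union> \<beta> - \<alpha>)) = d + 1 - int (card \<alpha>)"
      using card_new True finite_new disj
      by (simp add: card_Diff_subset card_Un_disjoint finite_subset card_mono of_nat_diff)
        (metis card_Un_disjoint card_mono finite_UnI of_nat_add of_nat_diff)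
    show ?thesis
    proof (rule cycles_bound_extend[where L = "link Y \<alpha>" and \<beta> = "\<beta> - \<alpha>" and \<gamma> = "\<alpha>' \<union> \<beta> - \<alpha>"])
      show "link X \<alpha> = link Y \<alpha> \<union> {\<tau>. \<beta> - \<alpha> \<subseteq> \<tau> \<and> \<tau> \<subseteq> \<alpha>' \<union> \<beta> - \<alpha>}"
        unfolding link_def using True by (subst faces_eq) blast
      show "\<And>\<tau>. \<tau> \<in> link Y \<alpha> \<Longrightarrow> \<not> \<beta> - \<alpha> \<subseteq> \<tau>"
        using not_old unfolding link_def by blast
      \<comment> \<open>The second alternative holds: the largest added face has
        \<open>d + 1 - card \<alpha>\<close> vertices, which exceeds \<open>n + 1\<close>.\<close>
      show "\<beta> - \<alpha> \<noteq> \<alpha>' \<union> \<beta> - \<alpha> \<or> n + 1 < int (card (\<alpha>' \<union> \<beta> - \<alpha>))"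
        using card assms(3) by simp
    qed (use step.IH link_finite_Union[OF complex(1)] link_subset[OF complex(1)] in auto)
  qed
qed


section \<open>Homology in extreme degrees\<close>

lemma cycles_diff:
  assumes "c \<in> simplicial_cycles K n" and "e \<in> simplicial_cycles K n"
  shows "c - e \<in> simplicial_cycles K n"
  using assms chains_diff unfolding simplicial_cycles_def by (auto simp: chain_boundary_diff)

lemma zero_in_cycles: "0 \<in> simplicial_cycles K n"
  using zero_in_chains unfolding simplicial_cycles_def chain_boundary_def by (auto simp: fun_eq_iff)

lemma zero_in_boundaries: "0 \<in> simplicial_boundaries K n"
proof -
  have "chain_boundary K 0 = 0" by (auto simp: chain_boundary_def)
  then show ?thesis unfolding simplicial_boundaries_def using zero_in_chains by (metis imageI)
qed

lemma homology_trivialI: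
  assumes "(simplicial_cycles K n :: ('a list \<Rightarrow> 'f::field) set) \<subseteq> simplicial_boundaries K n"
  shows "homology_trivial TYPE('f) K n"
proof -
  have "homologous K n `` {x} = simplicial_cycles K n"
    if "x \<in> simplicial_cycles K n" for x :: "'a list \<Rightarrow> 'f"
    using that cycles_diff[OF that] assms unfolding homologous_def by blast
  then have "reduced_homology K n = {simplicial_cycles K n :: ('a list \<Rightarrow> 'f) set}"
    unfolding reduced_homology_def quotient_def using zero_in_cycles by blast
  then show ?thesis unfolding homology_trivial_def by (simp add: is_singleton_def)
qed

lemma homology_trivialD:
  assumes "homology_trivial TYPE('f::field) K n"
    and z: "(z :: 'a list \<Rightarrow> 'f) \<in> simplicial_cycles K n"
  shows "z \<in> simplicial_boundaries K n"
proof -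
  have "homologous K n `` {z} = homologous K n `` {0}"
    using assms zero_in_cycles unfolding homology_trivial_def reduced_homology_def
    by (metis is_singleton_def quotientI singletonD)
  moreover have "0 \<in> homologous K n `` {0 :: 'a list \<Rightarrow> 'f}"
    unfolding homologous_def by (simp add: zero_in_cycles zero_in_boundaries)
  ultimately have "(z, 0) \<in> homologous K n" by blast
  then show ?thesis unfolding homologous_def by simp
qed

text \<open>No face has more than \<open>n + 1\<close> vertices, so no nonzero chain is left to take
  the boundary of. In top degree a nonzero cycle is thus a nonzero class.\<close>

lemma boundaries_top:
  assumes "\<And>\<sigma>. \<sigma> \<in> K \<Longrightarrow> int (card \<sigma>) \<le> n + 1"
  shows "simplicial_boundaries K n = {0 :: 'a list \<Rightarrow> 'f::field}"
proof -
  have "c = 0" if c: "c \<in> simplicial_chains K (n + 1)" for c :: "'a list \<Rightarrow> 'f"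
  proof
    fix xs
    show "c xs = 0 xs"
    proof (rule ccontr)
      assume "c xs \<noteq> 0 xs"
      then have "c xs \<noteq> 0" by simp
      from chainsD[OF c this] show False
        using assms[of "set xs"] distinct_card[of xs] by simp
    qed
  qed
  then have "simplicial_chains K (n + 1) = {0 :: 'a list \<Rightarrow> 'f}" using zero_in_chains by blast
  moreover have "chain_boundary K 0 = (0 :: 'a list \<Rightarrow> 'f)" by (auto simp: chain_boundary_def)
  ultimately show ?thesis unfolding simplicial_boundaries_def by simp
qed

text \<open>Without nonzero boundaries the homology classes are singletons, so the cycle space
  itself is a line.\<close>

lemma homology_line_top:
  assumes "homology_line TYPE('f::field) K n"
    and top: "simplicial_boundaries K n = {0 :: 'a list \<Rightarrow> 'f}"
    and x: "x \<in> simplicial_cycles K n" "x \<noteq> (0 :: 'a list \<Rightarrow> 'f)"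
    and y: "y \<in> simplicial_cycles K n"
  shows "\<exists>r. y = (\<lambda>vs. r * x vs)"
proof -
  obtain h :: "'f \<Rightarrow> ('a list \<Rightarrow> 'f) set"
    where h: "bij_betw h UNIV (reduced_homology K n)"
      and scale: "\<And>r a x. x \<in> h a \<Longrightarrow> (\<lambda>vs. r * x vs) \<in> h (r * a)"
    using assms(1) unfolding homology_line_def by blast
  have cls: "\<exists>a. h a = {z}" if z: "z \<in> simplicial_cycles K n" for z
  proof -
    have "homologous K n `` {z} = {z}"
      using z top unfolding homologous_def by auto
    then have "{z} \<in> reduced_homology K n"
      unfolding reduced_homology_def using quotientI[OF z, of "homologous K n"] by simp
    then show ?thesis using h unfolding bij_betw_def by (metis imageE)
  qed
  obtain a b where a: "h a = {x}" and b: "h b = {y}" using cls[OF x(1)] cls[OF y] by (elim exE)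
  \<comment> \<open>Otherwise scaling by zero would put the zero cycle into
    \<open>h 0 = {x}\<close>.\<close>
  have "a \<noteq> 0"
  proof
    assume "a = 0"
    then have "(\<lambda>vs. 0 * x vs) = x" using scale[of x a 0] a by simp
    then show False using x(2) by (auto simp: fun_eq_iff)
  qed
  then have "(\<lambda>vs. b / a * x vs) = y" using scale[of x a "b / a"] a b by simp
  then show ?thesis by metis
qed

lemma vertex_difference_cycle:
  assumes "{p} \<in> K" and "{q} \<in> K" and "p \<noteq> q" and "finite (\<Union>K)"
  shows "(\<lambda>xs. if xs = [p] then 1 else if xs = [q] then - 1 else 0 :: 'f::field)
           \<in> simplicial_cycles K 0" (is "?e \<in> _")
proof -
  have "?e \<in> simplicial_chains K 0"
  proof (rule chainsI)
    show "?e (xs @ x # y # ys) = - ?e (xs @ y # x # ys)" for xs x y ys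
      by (cases xs) auto
  qed (use assms in \<open>auto split: if_splits\<close>)
  moreover have "(\<Sum>v\<in>\<Union>K. ?e (v # ws)) = 0" for ws
  proof (cases "ws = []")
    case True
    have "(\<Sum>v\<in>\<Union>K. ?e [v]) = (\<Sum>v\<in>{p, q}. ?e [v])"
      using assms by (intro sum.mono_neutral_right) auto
    then show ?thesis unfolding True using assms(3) by simp
  qed (auto intro: sum.neutral)
  ultimately show ?thesis
    unfolding simplicial_cycles_def chain_boundary_def by (auto simp: fun_eq_iff)
qed

text \<open>No nonzero 0-cycle bounds, and the differences \<open>p - q\<close> and
  \<open>p - r\<close> are independent cycles, so homology in degree 0 has dimension at least
  two.\<close>

lemma three_points_homology:
  assumes dim: "\<And>\<sigma>. \<sigma> \<in> K \<Longrightarrow> int (card \<sigma>) \<le> 1" and fin: "finite (\<Union>K)"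
    and K: "{p} \<in> K" "{q} \<in> K" "{r} \<in> K" and ne: "p \<noteq> q" "p \<noteq> r" "q \<noteq> r"
  shows "\<not> homology_trivial TYPE('f::field) K 0" and "\<not> homology_line TYPE('f) K 0"
proof -
  define e where "e q = (\<lambda>xs. if xs = [p] then 1 else if xs = [q] then - 1 else 0 :: 'f)" for q
  have top: "simplicial_boundaries K 0 = {0 :: 'a list \<Rightarrow> 'f}"
    using boundaries_top[of K 0] dim by simp
  have e: "e q \<in> simplicial_cycles K 0" "e r \<in> simplicial_cycles K 0"
    unfolding e_def by (intro vertex_difference_cycle K ne fin)+
  have p: "e q [p] = 1" by (simp add: e_def)
  then have nz: "e q \<noteq> 0" by (metis zero_fun_apply zero_neq_one)
  show "\<not> homology_trivial TYPE('f) K 0"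
    using homology_trivialD[OF _ e(1)] top nz by auto
  show "\<not> homology_line TYPE('f) K 0"
  proof
    assume "homology_line TYPE('f) K 0"
    from homology_line_top[OF this top e(1) nz e(2)]
    obtain s where "e r = (\<lambda>vs. s * e q vs)" by blast
    from fun_cong[OF this, of "[r]"] show False using ne by (simp add: e_def)
  qed
qed

section \<open>Free ridges and pseudomanifolds\<close>

text \<open>Every face containing \<open>\<tau>\<close> lies in \<open>F\<close>, so the link is the
  full simplex on the nonempty set \<open>F - \<tau>\<close>.\<close>

lemma free_ridge_link_acyclic:
  assumes X: "pure_complex d X" and \<tau>: "\<tau> \<in> X" "face_dim \<tau> = d - 1"
    and free: "{G \<in> facets X. \<tau> \<subseteq> G} = {F}"
  shows "homology_acyclic TYPE('f::field) (link X \<tau>)"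
proof -
  have sc: "simplicial_complex X" using X unfolding pure_complex_def by blast
  have F: "F \<in> facets X" "\<tau> \<subseteq> F" using free by blast+
  then have FX: "F \<in> X" "finite F" using sc unfolding facets_def simplicial_complex_def by auto
  have "link X \<tau> = face_complex (F - \<tau>)"
  proof
    show "link X \<tau> \<subseteq> face_complex (F - \<tau>)"
    proof
      fix \<rho> assume "\<rho> \<in> link X \<tau>"
      then have \<rho>: "\<tau> \<inter> \<rho> = {}" "\<tau> \<union> \<rho> \<in> X" unfolding link_def by auto
      then obtain G where "G \<in> facets X" "\<tau> \<union> \<rho> \<subseteq> G" using exists_facet[OF sc] by blast
      then have "\<tau> \<union> \<rho> \<subseteq> F" using free by blast
      then show "\<rho> \<in> face_complex (F - \<tau>)" using \<rho>(1) unfolding face_complex_def by blast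
    qed
    show "face_complex (F - \<tau>) \<subseteq> link X \<tau>"
    proof
      fix \<rho> assume "\<rho> \<in> face_complex (F - \<tau>)"
      then have "\<rho> \<subseteq> F - \<tau>" unfolding face_complex_def by blast
      moreover from this have "\<tau> \<union> \<rho> \<in> X"
        using F(2) by (intro simplicial_complex_subset[OF sc FX(1)]) blast
      ultimately show "\<rho> \<in> link X \<tau>" unfolding link_def by blast
    qed
  qed
  moreover have ne: "F - \<tau> \<noteq> {}"
  proof
    assume "F - \<tau> = {}"
    then have "F = \<tau>" using F(2) by blast
    then show False using pure_card(1)[OF X F(1)] \<tau>(2) unfolding face_dim_def by simp
  qed
  moreover have "homology_trivial TYPE('f) (face_complex (F - \<tau>)) n" for n
    using ne FX(2) by (intro homology_trivialI cycles_bound_simplex) auto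
  ultimately show ?thesis unfolding homology_acyclic_def by metis
qed

lemma facets_face_complex: "facets (face_complex \<sigma>) = {\<sigma>}"
  unfolding facets_def face_complex_def by blast

text \<open>In the inductive step a small face \<open>\<sigma>\<close> of the new facet misses a vertex \<open>v\<close> of \<open>\<alpha>\<close>, and the
  ridge opposite to \<open>v\<close> contains \<open>\<beta>\<close>, hence is new.\<close>

lemma small_face_in_free_ridge:
  assumes "0 \<le> k" and "standard_ball d S"
    and "(\<lambda>Y Z. \<exists>\<alpha> \<beta>. shelling_move d \<alpha> \<beta> Y Z \<and> face_dim \<beta> < k)\<^sup>*\<^sup>* S X"
    and "\<sigma> \<in> X" and small: "d - face_dim \<sigma> \<ge> k + 1"
  shows "\<exists>\<tau>\<in>X. \<sigma> \<subseteq> \<tau> \<and> face_dim \<tau> = d - 1 \<and> (\<exists>F. {G \<in> facets X. \<tau> \<subseteq> G} = {F})"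
  using assms(3,4)
proof (induction rule: rtranclp_induct)
  case base
  obtain F where F: "finite F" "face_dim F = d" "S = face_complex F"
    using assms(2) unfolding standard_ball_def by blast
  have "\<sigma> \<subseteq> F" using base F unfolding face_complex_def by blast
  moreover have "\<sigma> \<noteq> F" using F(2) small assms(1) by auto
  ultimately obtain v where v: "v \<in> F" "v \<notin> \<sigma>" by blast
  have "card F > 0" using F(1) v(1) card_gt_0_iff by blast
  then have "face_dim (F - {v}) = d - 1"
    using F v by (simp add: face_dim_def of_nat_diff)
  moreover have "{G \<in> facets S. F - {v} \<subseteq> G} = {F}"
    unfolding F(3) facets_face_complex by blast
  moreover have "F - {v} \<in> S" "\<sigma> \<subseteq> F - {v}"
    using F(3) \<open>\<sigma> \<subseteq> F\<close> v unfolding face_complex_def by blast+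
  ultimately show ?case by blast
next
  case (step Y X)
  from step.hyps(2) obtain \<alpha> \<beta>
    where mv: "shelling_move d \<alpha> \<beta> Y X" and k: "face_dim \<beta> < k" by blast
  interpret shelling_step d \<alpha> \<beta> Y X using mv by unfold_locales
  show ?case
  proof (cases "\<sigma> \<subseteq> \<alpha> \<union> \<beta>")
    case True
    then have "finite \<sigma>" using finite_new finite_subset by blast
    \<comment> \<open>In vertex counts, \<open>card \<sigma> \<le> d - k\<close>, while
      \<open>card \<beta> \<le> k\<close> gives
      \<open>card \<alpha> \<ge> d + 1 - k\<close>.\<close>
    moreover have "card \<sigma> < card \<alpha>"
      using small k card_new unfolding face_dim_def by linarith
    ultimately have "\<not> \<alpha> \<subseteq> \<sigma>" using card_mono[of \<sigma> \<alpha>] by linarith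
    then obtain v where v: "v \<in> \<alpha>" "v \<notin> \<sigma>" by blast
    let ?\<tau> = "\<alpha> \<union> \<beta> - {v}"
    have \<beta>: "\<beta> \<subseteq> ?\<tau>" using v disj by blast
    have "{G \<in> facets X. ?\<tau> \<subseteq> G} = {\<alpha> \<union> \<beta>}"
    proof -
      have "\<not> ?\<tau> \<subseteq> G" if "G \<in> facets Y" for G
        using that not_old[of G] \<beta> unfolding facets_def by blast
      then show ?thesis unfolding facets_eq by blast
    qed
    moreover have "face_dim ?\<tau> = d - 1"
    proof -
      have "card (\<alpha> \<union> \<beta>) = Suc (card ?\<tau>)"
        using v finite_new by (intro card.remove) auto
      then show ?thesis
        using pure_card(1)[OF pure(1) new_facet(1)] unfolding face_dim_def by simp
    qed
    moreover have "?\<tau> \<in> X"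
      using \<beta> by (subst faces_eq) blast
    moreover have "\<sigma> \<subseteq> ?\<tau>" using True v by blast
    ultimately show ?thesis by blast
  next
    case False
    then have "\<sigma> \<in> Y" using step.prems faces_eq by blast
    from step.IH[OF this] obtain \<tau> F where \<tau>: "\<tau> \<in> Y" "\<sigma> \<subseteq> \<tau>" "face_dim \<tau> = d - 1"
      and F: "{G \<in> facets Y. \<tau> \<subseteq> G} = {F}" by (elim bexE exE conjE)
    \<comment> \<open>The new facet does not contain \<open>\<sigma>\<close>, hence not
      \<open>\<tau>\<close>, and the old free ridge stays free.\<close>
    have "\<not> \<tau> \<subseteq> \<alpha> \<union> \<beta>" using False \<tau>(2) by blast
    then have "{G \<in> facets X. \<tau> \<subseteq> G} = {F}" unfolding facets_eq using F by blast
    moreover have "\<tau> \<in> X" using \<tau>(1) sub by blast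
    ultimately show ?thesis using \<tau>(2,3) by (intro bexI[of _ \<tau>] conjI exI[of _ F])
  qed
qed

section \<open>Connectedness and the pseudomanifold condition\<close>

lemma shelled_pure:
  assumes "standard_ball d S" and "shells_to d S X"
  shows "pure_complex d X"
  using assms(2,1)
proof (induction rule: rtranclp_induct)
  case (step Y Z)
  then show ?case unfolding shelling_move_def by blast
qed (rule standard_ball_pure)

text \<open>Removing a vertex of \<open>\<beta>\<close> from the new facet leaves a ridge that is an
  old face. Any old facet containing this ridge is adjacent to the new one.\<close>

lemma shelled_connected:
  assumes "standard_ball d S" and "shells_to d S X"
    and "\<sigma> \<in> facets X" and "\<tau> \<in> facets X"
  shows "(\<sigma>, \<tau>) \<in> (dual_graph d X)\<^sup>*"
  using assms(2-4)
proof (induction arbitrary: \<sigma> \<tau> rule: rtranclp_induct)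
  case base
  then show ?case
    using assms(1) facets_face_complex unfolding standard_ball_def by (metis rtrancl.rtrancl_refl singletonD)
next
  case (step Y X)
  from step.hyps(2) obtain \<alpha> \<beta> where "shelling_move d \<alpha> \<beta> Y X" by blast
  then interpret shelling_step d \<alpha> \<beta> Y X by unfold_locales
  let ?F = "\<alpha> \<union> \<beta>"
  obtain b where b: "b \<in> \<beta>" using nonempty by blast
  then have "?F - {b} \<in> Y" using old_face[of "?F - {b}"] by blast
  then obtain G where G: "G \<in> facets Y" "?F - {b} \<subseteq> G" using exists_facet[OF complex(2)] by blast
  have "b \<notin> G" using not_old[of G] G unfolding facets_def by blast
  then have FG: "?F \<inter> G = ?F - {b}" "G \<inter> ?F = ?F - {b}" using G(2) by blast+
  have "card ?F = Suc (card (?F - {b}))"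
    using b finite_new by (intro card.remove) auto
  then have "face_dim (?F - {b}) = d - 1"
    using pure_card(1)[OF pure(1) new_facet(1)] unfolding face_dim_def by simp
  then have adj: "(?F, G) \<in> dual_graph d X" "(G, ?F) \<in> dual_graph d X"
    using FG G(1) facets_eq unfolding dual_graph_def by auto
  have "dual_graph d Y \<subseteq> dual_graph d X" unfolding dual_graph_def facets_eq by blast
  then have old: "(\<rho>, \<rho>') \<in> (dual_graph d X)\<^sup>*" if "\<rho> \<in> facets Y" "\<rho>' \<in> facets Y" for \<rho> \<rho>'
    using step.IH[OF that] rtrancl_mono by blast
  have "(\<rho>, G) \<in> (dual_graph d X)\<^sup>*" "(G, \<rho>) \<in> (dual_graph d X)\<^sup>*" if "\<rho> \<in> facets X" for \<rho>
    using that old[OF _ G(1)] old[OF G(1)] adj unfolding facets_eq by blast+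
  then show ?case using step.prems rtrancl_trans by metis
qed

text \<open>Three facets through a ridge give three vertices of its link, which has dimension at
  most 0. In a ball this link is acyclic or a homology 0-sphere, against
  \<open>three_points_homology\<close>.\<close>

lemma homology_ball_weak_pseudomanifold:
  assumes B: "homology_ball TYPE('f::field) d B" and pure: "pure_complex d B"
  shows "weak_pseudomanifold d B"
  unfolding weak_pseudomanifold_def
proof (intro conjI pure ballI impI)
  fix \<tau> assume \<tau>: "\<tau> \<in> B" "face_dim \<tau> = d - 1"
  let ?A = "{\<sigma> \<in> facets B. \<tau> \<subseteq> \<sigma>}"
  have sc: "simplicial_complex B" using pure unfolding pure_complex_def by blast
  have fin\<tau>: "finite \<tau>" using \<tau>(1) sc unfolding simplicial_complex_def by blast
  have "homology_acyclic TYPE('f) (link B \<tau>) \<or> homology_of_sphere TYPE('f) 0 (link B \<tau>)"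
  proof (cases "\<tau> = {}")
    case True
    \<comment> \<open>An empty ridge occurs only for \<open>d = 0\<close>; its link is the acyclic
      \<open>B\<close> itself.\<close>
    then have "link B \<tau> = B" unfolding link_def by simp
    then show ?thesis using B unfolding homology_ball_def by simp
  next
    case False
    then show ?thesis using B \<tau> unfolding homology_ball_def by force
  qed
  then have hom: "homology_trivial TYPE('f) (link B \<tau>) 0 \<or> homology_line TYPE('f) (link B \<tau>) 0"
    unfolding homology_acyclic_def homology_of_sphere_def by blast
  show "card ?A \<le> 2"
  proof (rule ccontr)
    assume "\<not> card ?A \<le> 2"
    then have "3 \<le> card ?A" by simp
    then obtain T where T: "T \<subseteq> ?A" "card T = 3" by (meson obtain_subset_with_card_n)
    from T(2) obtain P Q R where PQR: "T = {P, Q, R}" "P \<noteq> Q" "P \<noteq> R" "Q \<noteq> R"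
      unfolding card_3_iff by blast
    have A: "P \<in> ?A" "Q \<in> ?A" "R \<in> ?A" using T(1) unfolding PQR(1) by blast+
    have vertex: "\<exists>v. G = insert v \<tau> \<and> {v} \<in> link B \<tau>" if G: "G \<in> ?A" for G
    proof -
      have GB: "G \<in> B" "\<tau> \<subseteq> G" using G unfolding facets_def by auto
      have "int (card G) = d + 1" using pure_card(1)[OF pure] G by blast
      then have "card (G - \<tau>) = 1"
        using \<tau>(2) card_Diff_subset[OF fin\<tau> GB(2)] unfolding face_dim_def by simp
      then obtain v where "G - \<tau> = {v}" using card_1_singletonE by blast
      then have v: "G = insert v \<tau>" "v \<notin> \<tau>" using GB(2) by blast+
      then have "{v} \<in> link B \<tau>" using GB unfolding link_def by auto
      then show ?thesis using v by blast
    qed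
    obtain p q r where "P = insert p \<tau>" "Q = insert q \<tau>" "R = insert r \<tau>"
      and L: "{p} \<in> link B \<tau>" "{q} \<in> link B \<tau>" "{r} \<in> link B \<tau>"
      using vertex[OF A(1)] vertex[OF A(2)] vertex[OF A(3)] by (elim exE conjE)
    then have ne: "p \<noteq> q" "p \<noteq> r" "q \<noteq> r" using PQR(2-4) by auto
    have dim: "int (card \<rho>) \<le> 1" if "\<rho> \<in> link B \<tau>" for \<rho>
    proof -
      have \<rho>: "\<tau> \<inter> \<rho> = {}" "\<tau> \<union> \<rho> \<in> B" using that unfolding link_def by auto
      then have "finite \<rho>" using sc unfolding simplicial_complex_def by auto
      then show ?thesis
        using card_Un_disjoint[OF fin\<tau> _ \<rho>(1)] pure_card(2)[OF pure \<rho>(2)] \<tau>(2)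
        unfolding face_dim_def by simp
    qed
    show False
      using three_points_homology[OF dim link_finite_Union[OF sc] L ne] hom by blast
  qed
qed

text \<open>The simplex on \<open>\<beta>\<close> minus a chain of \<open>link Y \<alpha>\<close> with the same boundary is a cycle
  of top degree in \<open>link B \<alpha>\<close>.\<close>

lemma (in shelling_step) link_not_acyclic:
  assumes S: "standard_ball d S" "shells_to d S Y"
    and B: "pure_complex d B" "X \<subseteq> B"
  shows "\<not> homology_acyclic TYPE('f::field) (link B \<alpha>)"
proof
  assume acyclic: "homology_acyclic TYPE('f) (link B \<alpha>)"
  let ?M = "link B \<alpha>" and ?L = "link Y \<alpha>" and ?m = "face_dim \<beta>"
  have sc: "simplicial_complex B" using B(1) unfolding pure_complex_def by blast
  note finM = link_finite_Union[OF sc, of \<alpha>]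
  have LM: "?L \<subseteq> ?M" using B(2) sub unfolding link_def by blast
  have "\<alpha> \<union> \<beta> \<in> B" using new_facet(1) B(2) unfolding facets_def by blast
  then have "\<beta> \<in> ?M" using disj unfolding link_def by blast
  then have \<beta>M: "face_complex \<beta> \<subseteq> ?M"
    using link_subset[OF sc] unfolding face_complex_def by blast
  obtain e :: "'a list \<Rightarrow> 'f" and xs where e: "e \<in> simplicial_chains {\<beta>} ?m" and xs: "e xs \<noteq> 0"
    using simplex_chain[OF finite_new(2)] by blast
  have "{\<beta>} \<subseteq> face_complex \<beta>" unfolding face_complex_def by blast
  then have e\<beta>: "e \<in> simplicial_chains (face_complex \<beta>) ?m" using chains_mono e by blast
  then have eM: "e \<in> simplicial_chains ?M ?m" using chains_mono[OF \<beta>M] by blast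
  define b where "b = chain_boundary ?M e"
  have "chain_boundary (face_complex \<beta>) e \<in> simplicial_chains (face_complex \<beta>) (?m - 1)"
    using e\<beta> by (intro chain_boundary_in_chains) (auto simp: face_complex_def)
  then have b\<beta>: "b \<in> simplicial_chains (face_complex \<beta>) (?m - 1)"
    unfolding b_def chain_boundary_subcomplex[OF e\<beta> \<beta>M finM] .
  \<comment> \<open>The boundary of the simplex lives on proper subsets of \<open>\<beta>\<close>,
    whose unions with \<open>\<alpha>\<close> are old faces.\<close>
  have bL: "b \<in> simplicial_chains ?L (?m - 1)"
  proof (rule chains_restrict[OF b\<beta>])
    fix ys assume nz: "b ys \<noteq> 0"
    have ys: "set ys \<subseteq> \<beta>" using chainsD(2)[OF b\<beta> nz] unfolding face_complex_def by blast
    have "int (card (set ys)) < int (card \<beta>)"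
      using chainsD(1,3)[OF b\<beta> nz] distinct_card[of ys] unfolding face_dim_def by simp
    then have "\<not> \<beta> \<subseteq> set ys" using ys by auto
    then have "\<alpha> \<union> set ys \<in> Y" using old_face[of "\<alpha> \<union> set ys"] ys disj by blast
    then show "set ys \<in> ?L" using ys disj unfolding link_def by blast
  qed
  have "chain_boundary ?L b = 0"
    unfolding chain_boundary_subcomplex[OF bL LM finM] unfolding b_def
    by (rule chain_boundary_boundary[OF eM finM])
  then have "b \<in> simplicial_cycles ?L (?m - 1)" using bL unfolding simplicial_cycles_def by blast
  \<comment> \<open>By \<open>card_new\<close> this is an equality: \<open>b\<close> lies exactly
    one degree below the top of the link.\<close>
  moreover have "?m - 1 + 1 + int (card \<alpha>) \<le> d" using card_new unfolding face_dim_def by simp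
  ultimately have "b \<in> simplicial_boundaries ?L (?m - 1)"
    using shelled_link_cycles_bound[OF S] by blast
  then obtain w where w: "w \<in> simplicial_chains ?L ?m" and bw: "b = chain_boundary ?L w"
    unfolding simplicial_boundaries_def by auto
  have wM: "w \<in> simplicial_chains ?M ?m" using chains_mono[OF LM] w by blast
  have "chain_boundary ?M (e - w) = 0"
    using bw chain_boundary_subcomplex[OF w LM finM] b_def by (simp add: chain_boundary_diff)
  then have "e - w \<in> simplicial_cycles ?M ?m"
    using chains_diff[OF eM wM] unfolding simplicial_cycles_def by blast
  then have "e - w \<in> simplicial_boundaries ?M ?m"
    using acyclic homology_trivialD unfolding homology_acyclic_def by blast
  also have "simplicial_boundaries ?M ?m = {0}"
  proof (rule boundaries_top)
    fix \<sigma> assume "\<sigma> \<in> ?M"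
    then have \<sigma>: "\<alpha> \<inter> \<sigma> = {}" "\<alpha> \<union> \<sigma> \<in> B" unfolding link_def by auto
    then have "finite \<sigma>" using sc unfolding simplicial_complex_def by auto
    then show "int (card \<sigma>) \<le> ?m + 1"
      using card_Un_disjoint[OF finite_new(1) _ \<sigma>(1)] pure_card(2)[OF B(1) \<sigma>(2)] card_new
      unfolding face_dim_def by simp
  qed
  finally have "e = w" by (simp add: fun_eq_iff)
  \<comment> \<open>\<open>e\<close> is supported on \<open>\<beta>\<close> alone, whereas
    \<open>w\<close> lives on the link in \<open>Y\<close>, which does not contain
    \<open>\<beta>\<close>.\<close>
  then have "set xs \<in> ?L" "set xs = \<beta>" using chainsD(2)[OF w] chainsD(2)[OF e] xs by auto
  then show False using not_old[of "\<alpha> \<union> \<beta>"] unfolding link_def by blast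
qed

section \<open>Bounded index versus stackedness\<close>

theorem theorem2p7:
  fixes k d :: int and B :: "'a set set"
  assumes "0 \<le> k" and "k \<le> d + 1"
    and "homology_ball TYPE('f::field) (d + 1) B"
  shows "k_shelled k (d + 1) B \<longleftrightarrow>
           shellable (d + 1) B \<and> k_stacked TYPE('f) k (d + 1) B"
proof
  let ?move = "\<lambda>Y Z. \<exists>\<alpha> \<beta>. shelling_move (d + 1) \<alpha> \<beta> Y Z \<and> face_dim \<beta> < k"
  {
    assume "k_shelled k (d + 1) B"
    then obtain S where S: "standard_ball (d + 1) S" "?move\<^sup>*\<^sup>* S B"
      unfolding k_shelled_def by blast
    have SB: "shells_to (d + 1) S B"
      using S(2) by (rule rtranclp_mono[THEN predicate2D, rotated]) blast
    have B_pure: "pure_complex (d + 1) B" using shelled_pure[OF S(1) SB] .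
    have "\<sigma> \<in> ball_boundary TYPE('f) B" if \<sigma>: "\<sigma> \<in> B" "d + 1 - face_dim \<sigma> \<ge> k + 1" for \<sigma>
    proof -
      obtain \<tau> F where \<tau>: "\<tau> \<in> B" "\<sigma> \<subseteq> \<tau>" "face_dim \<tau> = d + 1 - 1"
        "{G \<in> facets B. \<tau> \<subseteq> G} = {F}"
        using small_face_in_free_ridge[OF assms(1) S \<sigma>] by blast
      have "\<tau> \<in> ball_boundary TYPE('f) B"
        using free_ridge_link_acyclic[OF B_pure \<tau>(1,3,4)] \<tau>(1) unfolding ball_boundary_def by blast
      \<comment> \<open>The boundary of a ball is a homology sphere, hence closed under subsets, so
        membership descends from \<open>\<tau>\<close> to \<open>\<sigma>\<close>.\<close>
      moreover have "simplicial_complex (ball_boundary TYPE('f) B)"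
        using assms(3) unfolding homology_ball_def homology_sphere_def by blast
      ultimately show ?thesis using simplicial_complex_subset \<tau>(2) by blast
    qed
    then show "shellable (d + 1) B \<and> k_stacked TYPE('f) k (d + 1) B"
      using S(1) SB assms(3) unfolding shellable_def k_stacked_def by blast
  next
    assume "shellable (d + 1) B \<and> k_stacked TYPE('f) k (d + 1) B"
    then obtain S where S: "standard_ball (d + 1) S" "shells_to (d + 1) S B"
      and stacked: "k_stacked TYPE('f) k (d + 1) B"
      unfolding shellable_def by blast
    have B_pure: "pure_complex (d + 1) B" using shelled_pure[OF S] .
    \<comment> \<open>The induction carries \<open>Z \<subseteq> B\<close> along because stackedness
      concerns links in the final complex \<open>B\<close>, not in the complex reached so
      far.\<close>
    have "?move\<^sup>*\<^sup>* S Z" if "shells_to (d + 1) S Z" "Z \<subseteq> B" for Z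
      using that
    proof (induction rule: rtranclp_induct)
      case (step Y X)
      from step.hyps(2) obtain \<alpha> \<beta> where mv: "shelling_move (d + 1) \<alpha> \<beta> Y X" by blast
      interpret shelling_step "d + 1" \<alpha> \<beta> Y X using mv by unfold_locales
      have "\<alpha> \<in> B" using mv step.prems unfolding shelling_move_def by blast
      then have "\<not> d + 1 - face_dim \<alpha> \<ge> k + 1"
        using stacked link_not_acyclic[OF S(1) step.hyps(1) B_pure step.prems]
        unfolding k_stacked_def ball_boundary_def by blast
      \<comment> \<open>As \<open>card \<alpha> + card \<beta> = d + 2\<close>, the codimension of
        \<open>\<alpha>\<close> in \<open>B\<close> is \<open>face_dim \<beta> + 1\<close>.\<close>
      then have "face_dim \<beta> < k" using card_new unfolding face_dim_def by simp
      with mv have "?move Y X" by blast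
      moreover have "?move\<^sup>*\<^sup>* S Y" using step.IH step.prems sub by blast
      ultimately show ?case by (rule rtranclp.rtrancl_into_rtrancl[rotated])
    qed simp
    moreover have "pseudomanifold (d + 1) B"
      using homology_ball_weak_pseudomanifold[OF assms(3) B_pure] shelled_connected[OF S]
      unfolding pseudomanifold_def by blast
    ultimately show "k_shelled k (d + 1) B"
      using S assms(1,2) unfolding k_shelled_def by blast
  }
qed

end
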